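(* Let $(G,\rho)$ be a reduced maximal Gallai multigraph. The vertices connected by two edges form uniformly colored cliques: that is, if $u,v,w$ are distinct vertices with $|\rho[uv]|=|\rho[vw]|=2$, then $\rho[uw]=\rho[uv]=\rho[vw]$ (in particular $|\rho[uw]|=2$).
   Context: An edge-colored (complete, loopless) multigraph $(G,\rho)$ has a finite vertex set $\mathcal V\subseteq\mathbb N$ and assigns to each unordered pair of distinct vertices $u,v$ a nonempty finite set $\rho[uv]$ of colors (the colors of the parallel edges joining $u$ and $v$; parallel edges have distinct colors). Three distinct vertices $u,v,w$ form a rainbow triangle if there are pairwise distinct colors $X\in\rho[uv]$, $Y\in\rho[vw]$, $Z\in\rho[uw]$. $(G,\rho)$ is a Gallai multigraph if it has no rainbow triangle; it is maximal if for every pair $u,v$ and every color $B\notin\rho[uv]$, adding $B$ to $\rho[uv]$ would create a rainbow triangle. A pair $u,v$ is isolated if $\rho[uw]=\rho[vw]$ and $|\rho[uw]|=1$ for every vertex $w\notin\{u,v\}$; $G$ is reduced if no pair is isolated. *)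

theory Defs
  imports Main
begin

text \<open>
  A multigraph is given by its vertex set \<open>V\<close> and the map \<open>\<rho>\<close> from unordered pairs
  (two-element sets \<open>{u, v}\<close>) to sets of colors.  Values of \<open>\<rho>\<close> on arguments that are not
  two-element subsets of \<open>V\<close> play no role.  The type \<open>'c\<close> is the palette of available
  colors; it is arbitrary and may be infinite.
\<close>

definition multigraph :: "nat set \<Rightarrow> (nat set \<Rightarrow> 'c set) \<Rightarrow> bool" where
  "multigraph V \<rho> \<longleftrightarrow> finite V \<and>
     (\<forall>u\<in>V. \<forall>v\<in>V. u \<noteq> v \<longrightarrow> finite (\<rho> {u, v}) \<and> \<rho> {u, v} \<noteq> {})"

definition rainbow_triangle :: "(nat set \<Rightarrow> 'c set) \<Rightarrow> nat \<Rightarrow> nat \<Rightarrow> nat \<Rightarrow> bool" where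
  "rainbow_triangle \<rho> u v w \<longleftrightarrow> u \<noteq> v \<and> v \<noteq> w \<and> u \<noteq> w \<and>
     (\<exists>X\<in>\<rho> {u, v}. \<exists>Y\<in>\<rho> {v, w}. \<exists>Z\<in>\<rho> {u, w}. X \<noteq> Y \<and> Y \<noteq> Z \<and> X \<noteq> Z)"

definition has_rainbow_triangle :: "nat set \<Rightarrow> (nat set \<Rightarrow> 'c set) \<Rightarrow> bool" where
  "has_rainbow_triangle V \<rho> \<longleftrightarrow> (\<exists>u\<in>V. \<exists>v\<in>V. \<exists>w\<in>V. rainbow_triangle \<rho> u v w)"

definition gallai_multigraph :: "nat set \<Rightarrow> (nat set \<Rightarrow> 'c set) \<Rightarrow> bool" where
  "gallai_multigraph V \<rho> \<longleftrightarrow> multigraph V \<rho> \<and> \<not> has_rainbow_triangle V \<rho>"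

definition add_edge :: "(nat set \<Rightarrow> 'c set) \<Rightarrow> nat \<Rightarrow> nat \<Rightarrow> 'c \<Rightarrow> nat set \<Rightarrow> 'c set" where
  "add_edge \<rho> u v B = \<rho>({u, v} := insert B (\<rho> {u, v}))"

definition maximal_gallai_multigraph :: "nat set \<Rightarrow> (nat set \<Rightarrow> 'c set) \<Rightarrow> bool" where
  "maximal_gallai_multigraph V \<rho> \<longleftrightarrow> gallai_multigraph V \<rho> \<and>
     (\<forall>u\<in>V. \<forall>v\<in>V. u \<noteq> v \<longrightarrow>
        (\<forall>B. B \<notin> \<rho> {u, v} \<longrightarrow> has_rainbow_triangle V (add_edge \<rho> u v B)))"

definition isolated_pair :: "nat set \<Rightarrow> (nat set \<Rightarrow> 'c set) \<Rightarrow> nat \<Rightarrow> nat \<Rightarrow> bool" where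
  "isolated_pair V \<rho> u v \<longleftrightarrow>
     (\<forall>w\<in>V - {u, v}. \<rho> {u, w} = \<rho> {v, w} \<and> card (\<rho> {u, w}) = 1)"

definition reduced :: "nat set \<Rightarrow> (nat set \<Rightarrow> 'c set) \<Rightarrow> bool" where
  "reduced V \<rho> \<longleftrightarrow> (\<forall>u\<in>V. \<forall>v\<in>V. u \<noteq> v \<longrightarrow> \<not> isolated_pair V \<rho> u v)"

end

theory Submission
  imports Defs
begin

text \<open>
  If two edge colors \<open>a, b\<close> join \<open>v\<close> to \<open>w\<close> and a third color \<open>d\<close> joins \<open>w\<close> to \<open>x\<close>, then
  \<open>\<rho> {v, x} = {d}\<close>.  For double edges \<open>uv\<close> and \<open>vw\<close> this forces both to carry the same
  colors \<open>a, b\<close> and \<open>uw\<close> to carry no other.  If \<open>uw\<close> lacked \<open>b\<close>, maximality would give a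
  vertex \<open>x\<close> for which \<open>ux\<close> and \<open>wx\<close> together carry \<open>a\<close> and a third color \<open>d\<close>; then \<open>d\<close>
  propagates through \<open>v\<close> to the edge carrying \<open>a\<close>, a contradiction.
\<close>

lemma gallai_triangle:
  assumes "gallai_multigraph V \<rho>" "u \<in> V" "v \<in> V" "w \<in> V" "u \<noteq> v" "v \<noteq> w" "u \<noteq> w"
    and "X \<in> \<rho> {u, v}" "Y \<in> \<rho> {v, w}" "Z \<in> \<rho> {u, w}"
  shows "X = Y \<or> Y = Z \<or> X = Z"
  using assms unfolding gallai_multigraph_def has_rainbow_triangle_def rainbow_triangle_def
  by blast

text \<open>A color \<open>e\<close> on \<open>vx\<close> other than \<open>d\<close> would have to
  equal \<open>a\<close>, by the triangle with colors \<open>a\<close>, \<open>d\<close>,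
  \<open>e\<close>, and likewise \<open>b\<close>, which is impossible. Nonemptiness of
  \<open>\<rho> {v, x}\<close> then gives equality.\<close>

lemma third_color_propagates:
  assumes G: "gallai_multigraph V \<rho>"
    and V: "v \<in> V" "w \<in> V" "x \<in> V" "v \<noteq> w" "w \<noteq> x" "v \<noteq> x"
    and ab: "a \<in> \<rho> {v, w}" "b \<in> \<rho> {v, w}" "a \<noteq> b"
    and d: "d \<in> \<rho> {w, x}" "d \<noteq> a" "d \<noteq> b"
  shows "\<rho> {v, x} = {d}"
proof -
  have "e = d" if "e \<in> \<rho> {v, x}" for e
    using gallai_triangle[OF G V ab(1) d(1) that] gallai_triangle[OF G V ab(2) d(1) that] ab(3) d
    by auto
  moreover have "\<rho> {v, x} \<noteq> {}"
    using G V unfolding gallai_multigraph_def multigraph_def by blast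
  ultimately show ?thesis by blast
qed

text \<open>A rainbow triangle created by the new edge must use it, since the old multigraph has
  none. The third vertex is \<open>x\<close>; the other two sides differ in color from
  \<open>B\<close>, so they are old edges.\<close>

lemma maximal_missing_color:
  assumes M: "maximal_gallai_multigraph V \<rho>"
    and V: "u \<in> V" "w \<in> V" "u \<noteq> w" and B: "B \<notin> \<rho> {u, w}"
  obtains x c d where "x \<in> V" "x \<noteq> u" "x \<noteq> w" "c \<in> \<rho> {u, x}" "d \<in> \<rho> {w, x}"
    "c \<noteq> d" "c \<noteq> B" "d \<noteq> B"
proof -
  let ?\<sigma> = "add_edge \<rho> u w B"
  from M V B have "has_rainbow_triangle V ?\<sigma>" and G: "gallai_multigraph V \<rho>"
    unfolding maximal_gallai_multigraph_def by auto
  then obtain p q r X Y Z where T: "p \<in> V" "q \<in> V" "r \<in> V" "p \<noteq> q" "q \<noteq> r" "p \<noteq> r"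
    and X: "X \<in> ?\<sigma> {p, q}" and Y: "Y \<in> ?\<sigma> {q, r}" and Z: "Z \<in> ?\<sigma> {p, r}"
    and D: "X \<noteq> Y" "Y \<noteq> Z" "X \<noteq> Z"
    unfolding has_rainbow_triangle_def rainbow_triangle_def by blast
  have old: "C \<in> \<rho> {s, t} \<or> {s, t} = {u, w} \<and> C = B" if "C \<in> ?\<sigma> {s, t}" for C s t
    using that unfolding add_edge_def by (auto split: if_splits)
  have "\<not> (X \<in> \<rho> {p, q} \<and> Y \<in> \<rho> {q, r} \<and> Z \<in> \<rho> {p, r})"
    using gallai_triangle[OF G T] D by blast
  then consider "{p, q} = {u, w}" "X = B" | "{q, r} = {u, w}" "Y = B" | "{p, r} = {u, w}" "Z = B"
    using old[OF X] old[OF Y] old[OF Z] by blast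
  \<comment> \<open>The new edge may be any of the three sides, traversed in either direction;
    \<open>x\<close> is the vertex off that side.\<close>
  then show thesis
  proof cases
    case 1
    then have "p = u \<and> q = w \<or> p = w \<and> q = u" by (simp add: doubleton_eq_iff)
    moreover have "Y \<in> \<rho> {q, r}" "Z \<in> \<rho> {p, r}" using 1 old[OF Y] old[OF Z] D by blast+
    ultimately show ?thesis using 1 T D that[of r Y Z] that[of r Z Y] by metis
  next
    case 2
    then have "q = u \<and> r = w \<or> q = w \<and> r = u" by (simp add: doubleton_eq_iff)
    moreover have "X \<in> \<rho> {q, p}" "Z \<in> \<rho> {r, p}"
      using 2 old[OF X] old[OF Z] D by (metis insert_commute)+
    ultimately show ?thesis using 2 T D that[of p X Z] that[of p Z X] by metis
  next
    case 3
    then have "p = u \<and> r = w \<or> p = w \<and> r = u" by (simp add: doubleton_eq_iff)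
    moreover have "X \<in> \<rho> {p, q}" "Y \<in> \<rho> {r, q}"
      using 3 old[OF X] old[OF Y] D by (metis insert_commute)+
    ultimately show ?thesis using 3 T D that[of q X Y] that[of q Y X] by metis
  qed
qed

lemma double_edges_same_colors:
  assumes G: "gallai_multigraph V \<rho>"
    and V: "u \<in> V" "v \<in> V" "w \<in> V" "u \<noteq> v" "v \<noteq> w" "u \<noteq> w"
    and card: "card (\<rho> {u, v}) = 2" "card (\<rho> {v, w}) = 2"
  shows "\<rho> {v, w} = \<rho> {u, v}" and "\<rho> {u, w} \<subseteq> \<rho> {u, v}"
proof -
  obtain a b where ab: "\<rho> {u, v} = {a, b}" "a \<noteq> b"
    using card(1) by (auto simp: card_2_iff)
  show sub: "\<rho> {u, w} \<subseteq> \<rho> {u, v}"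
  proof (rule ccontr)
    assume "\<not> ?thesis"
    then obtain d where "d \<in> \<rho> {u, w}" "d \<noteq> a" "d \<noteq> b" using ab by auto
    then have "\<rho> {v, w} = {d}"
      \<comment> \<open>The color \<open>d\<close> passes from \<open>uw\<close> through the double
        edge \<open>vu\<close> and would leave \<open>vw\<close> single.\<close>
      using third_color_propagates[OF G, of v u w a b d] V ab by (auto simp: insert_commute)
    then show False using card(2) by simp
  qed
  have "\<rho> {v, w} \<subseteq> \<rho> {u, v}"
  proof (rule ccontr)
    assume "\<not> ?thesis"
    then obtain d where "d \<in> \<rho> {v, w}" "d \<noteq> a" "d \<noteq> b" using ab by auto
    \<comment> \<open>Now \<open>d\<close> passes from \<open>vw\<close> to \<open>uw\<close>, where
      the inclusion already proved excludes it.\<close>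
    then have "\<rho> {u, w} = {d}"
      using third_color_propagates[OF G, of u v w a b d] V ab by auto
    then show False using sub ab \<open>d \<noteq> a\<close> \<open>d \<noteq> b\<close> by auto
  qed
  then show "\<rho> {v, w} = \<rho> {u, v}"
    using card ab by (intro card_subset_eq) auto
qed

theorem theorem2p2:
  fixes V :: "nat set" and \<rho> :: "nat set \<Rightarrow> 'c set" and u v w :: nat
  assumes "maximal_gallai_multigraph V \<rho>" and "reduced V \<rho>"
    and "u \<in> V" and "v \<in> V" and "w \<in> V"
    and "u \<noteq> v" and "v \<noteq> w" and "u \<noteq> w"
    and "card (\<rho> {u, v}) = 2" and "card (\<rho> {v, w}) = 2"
  shows "\<rho> {u, w} = \<rho> {u, v} \<and> \<rho> {u, v} = \<rho> {v, w} \<and> card (\<rho> {u, w}) = 2"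
proof -
  have G: "gallai_multigraph V \<rho>"
    using assms(1) unfolding maximal_gallai_multigraph_def by blast
  note same = double_edges_same_colors[OF G assms(3-8), OF assms(9,10)]
  \<comment> \<open>Here \<open>s\<close> and \<open>t\<close> stand for \<open>u\<close> and
    \<open>w\<close> in either order. The color \<open>d\<close> moves from \<open>tx\<close> to
    \<open>vx\<close> through the double edge \<open>vt\<close>, then to \<open>sx\<close> through
    \<open>sv\<close>, leaving no room there for \<open>a\<close>.\<close>
  have no_third: False
    if V: "s \<in> V" "t \<in> V" "x \<in> V" "s \<noteq> v" "t \<noteq> v" "x \<noteq> v" "s \<noteq> x" "t \<noteq> x"
      and ab: "\<rho> {s, v} = {a, b}" "\<rho> {v, t} = {a, b}" "a \<noteq> b"
      and a: "a \<in> \<rho> {s, x}" and d: "d \<in> \<rho> {t, x}" "d \<noteq> a" "d \<noteq> b"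
    for s t x a b d
  proof -
    have in_ab: "a \<in> \<rho> {s, v}" "b \<in> \<rho> {s, v}" "a \<in> \<rho> {v, t}" "b \<in> \<rho> {v, t}"
      unfolding ab by blast+
    have "v \<noteq> t" "v \<noteq> x" using V by blast+
    then have "\<rho> {v, x} = {d}"
      using V assms(4) in_ab ab(3) d
      by (intro third_color_propagates[OF G, of v t x a b d])
    then have "d \<in> \<rho> {v, x}" by blast
    then have "\<rho> {s, x} = {d}"
      using V assms(4) \<open>v \<noteq> x\<close> in_ab ab(3) d
      by (intro third_color_propagates[OF G, of s v x a b d])
    then show False using a d by simp
  qed
  have "\<rho> {u, v} \<subseteq> \<rho> {u, w}"
  proof
    fix b assume b: "b \<in> \<rho> {u, v}"
    show "b \<in> \<rho> {u, w}"
    proof (rule ccontr)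
      assume nb: "b \<notin> \<rho> {u, w}"
      obtain a where ab: "\<rho> {u, v} = {a, b}" "a \<noteq> b"
        using assms(9) b unfolding card_2_iff by (metis insertE insert_commute singletonD)
      have vw: "\<rho> {v, w} = {a, b}" using same(1) ab by simp
      have vu: "\<rho> {v, u} = {a, b}" and wv: "\<rho> {w, v} = {a, b}"
        using ab vw by (simp_all only: insert_commute[of v _ "{}"])
      have "\<rho> {u, w} \<noteq> {}"
        using G assms(3,5,8) unfolding gallai_multigraph_def multigraph_def by blast
      then have a: "a \<in> \<rho> {u, w}" using same(2) ab nb by auto
      obtain x c d where x: "x \<in> V" "x \<noteq> u" "x \<noteq> w"
        and cd: "c \<in> \<rho> {u, x}" "d \<in> \<rho> {w, x}" "c \<noteq> d" "c \<noteq> b" "d \<noteq> b"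
        using maximal_missing_color[OF assms(1,3,5,8) nb] .
      \<comment> \<open>The triangle \<open>u\<close>, \<open>w\<close>, \<open>x\<close> is not
        rainbow and \<open>c \<noteq> d\<close>, so one of \<open>c\<close>, \<open>d\<close> is
        \<open>a\<close> and the other is a third color.\<close>
      have "a = d \<or> d = c \<or> a = c"
        using gallai_triangle[OF G, of u w x a d c] assms(3,5,8) x a cd by auto
      then have ac: "a = c \<or> a = d" using cd by auto
      \<comment> \<open>If \<open>x = v\<close>, both \<open>c\<close> and \<open>d\<close> lie in
        \<open>{a, b}\<close> and avoid \<open>b\<close>, hence coincide.\<close>
      have "x \<noteq> v" using ac cd ab wv by auto
      from ac show False
      proof
        assume "a = c"
        then show False
          using no_third[of u w x a b d] assms(3-8) x \<open>x \<noteq> v\<close> cd ab vw by metis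
      next
        assume "a = d"
        then show False
          using no_third[of w u x a b c] assms(3-8) x \<open>x \<noteq> v\<close> cd ab vu wv by metis
      qed
    qed
  qed
  then show ?thesis using same assms(9) by auto
qed

end
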